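(* Let $V$ be a finite-dimensional real vector space and let $\mathcal{A}\in\mathfrak{F}(V)$ be an equiaffine algebraic curvature operator on $V$. Then there exists an equiaffine (torsion free) connection $\nabla$ on the tangent bundle $T(V)$ of the smooth manifold $V$ such that its curvature operator at the origin satisfies $\mathcal{R}^\nabla_0=\mathcal{A}$.
   Context: Let $V$ be a real vector space of finite dimension $m$. An algebraic curvature operator on $V$ is an element $\mathcal{A}\in\otimes^2V^*\otimes\operatorname{End}(V)$ such that for all $x,y,z\in V$: $\mathcal{A}(x,y)z=-\mathcal{A}(y,x)z$ and $\mathcal{A}(x,y)z+\mathcal{A}(y,z)x+\mathcal{A}(z,x)y=0$. The space of these is denoted $\mathfrak{A}(V)$. The Ricci tensor of $\mathcal{A}$ is $\rho(x,y):=\operatorname{Tr}\{z\mapsto\mathcal{A}(z,x)y\}$. $\mathcal{A}$ is called an equiaffine (or Ricci symmetric) curvature operator if $\rho(x,y)=\rho(y,x)$ for all $x,y\in V$; $\mathfrak{F}(V)\subset\mathfrak{A}(V)$ denotes the set of all such operators. All connections are smooth torsion free connections on the tangent bundle $TM$ of a smooth manifold $M$. The curvature operator of $\nabla$ is $\mathcal{R}^\nabla(X,Y)Z=\nabla_X\nabla_YZ-\nabla_Y\nabla_XZ-\nabla_{[X,Y]}Z$, and $\mathcal{R}^\nabla_P\in\mathfrak{A}(T_PM)$ denotes its value at $P\in M$. A connection is equiaffine if it locally admits a parallel volume form, i.e. every point has a neighborhood on which there is a nowhere vanishing top-degree form $\Omega$ with $\nabla\Omega=0$; equivalently, its Ricci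 tensor (defined from $\mathcal{R}^\nabla_P$ by the same trace formula at each point $P$) is symmetric. When $M=V$, the tangent space $T_0V$ is canonically identified with $V$. *)

theory Defs
  imports "HOL-Analysis.Analysis"
begin

section \<open>Algebraic curvature operators\<close>

text \<open>
  \<open>A x y z\<close> stands for \<open>\<A>(x,y)z\<close>.
\<close>

definition algebraic_curvature_operator ::
    "('a::real_vector \<Rightarrow> 'a \<Rightarrow> 'a \<Rightarrow> 'a) \<Rightarrow> bool" where
  "algebraic_curvature_operator A \<longleftrightarrow>
     (\<forall>y z. linear (\<lambda>x. A x y z)) \<and>
     (\<forall>x z. linear (\<lambda>y. A x y z)) \<and>
     (\<forall>x y. linear (\<lambda>z. A x y z)) \<and>
     (\<forall>x y z. A x y z = - A y x z) \<and>
     (\<forall>x y z. A x y z + A y z x + A z x y = 0)"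

text \<open>
  The trace of an endomorphism: the sum of the diagonal entries of its matrix with respect to
  some basis. Only meaningful for a linear map on a space of finite dimension, where
  it does not depend on the basis chosen.
\<close>

definition endo_trace :: "('a::real_vector \<Rightarrow> 'a) \<Rightarrow> real" where
  "endo_trace f =
     (let B = (SOME B. independent B \<and> span B = UNIV)
      in \<Sum>b\<in>B. representation B (f b) b)"

definition ricci :: "('a::real_vector \<Rightarrow> 'a \<Rightarrow> 'a \<Rightarrow> 'a) \<Rightarrow> 'a \<Rightarrow> 'a \<Rightarrow> real" where
  "ricci A x y = endo_trace (\<lambda>z. A z x y)"

definition equiaffine_curvature_operator ::
    "('a::real_vector \<Rightarrow> 'a \<Rightarrow> 'a \<Rightarrow> 'a) \<Rightarrow> bool" where
  "equiaffine_curvature_operator A \<longleftrightarrow>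
     algebraic_curvature_operator A \<and> (\<forall>x y. ricci A x y = ricci A y x)"


section \<open>Smooth maps\<close>

text \<open>
  Both notions are meant for an open set \<open>S\<close> of a finite-dimensional space. There all norms
  are equivalent, so nothing below depends on the norm of the type.
\<close>

primrec higher_differentiable_on ::
    "'a::real_normed_vector set \<Rightarrow> ('a \<Rightarrow> 'b::real_normed_vector) \<Rightarrow> nat \<Rightarrow> bool" where
  "higher_differentiable_on S f 0 \<longleftrightarrow> continuous_on S f"
| "higher_differentiable_on S f (Suc n) \<longleftrightarrow>
     (\<forall>x\<in>S. f differentiable (at x)) \<and>
     (\<forall>v. higher_differentiable_on S (\<lambda>x. frechet_derivative f (at x) v) n)"

definition smooth_on ::
    "'a::real_normed_vector set \<Rightarrow> ('a \<Rightarrow> 'b::real_normed_vector) \<Rightarrow> bool" where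
  "smooth_on S f \<longleftrightarrow> (\<forall>n. higher_differentiable_on S f n)"


section \<open>Torsion free connections on the tangent bundle of a vector space\<close>

text \<open>
  Under the canonical identification of every tangent space of \<open>V\<close> with \<open>V\<close>, the smooth
  vector fields on \<open>V\<close> are the smooth maps from \<open>V\<close> to \<open>V\<close>. A connection is given by its
  covariant derivative, where \<open>nabla X Y\<close> stands for \<open>\<nabla>\<^sub>X Y\<close>; only its values at smooth vector
  fields matter.
\<close>

abbreviation vector_field :: "('a::real_normed_vector \<Rightarrow> 'a) \<Rightarrow> bool" where
  "vector_field X \<equiv> smooth_on UNIV X"

definition dir_deriv ::
    "('a::real_normed_vector \<Rightarrow> 'a) \<Rightarrow> ('a \<Rightarrow> 'b::real_normed_vector) \<Rightarrow> 'a \<Rightarrow> 'b" where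
  "dir_deriv X f p = frechet_derivative f (at p) (X p)"

definition lie_bracket ::
    "('a::real_normed_vector \<Rightarrow> 'a) \<Rightarrow> ('a \<Rightarrow> 'a) \<Rightarrow> 'a \<Rightarrow> 'a" where
  "lie_bracket X Y p = dir_deriv X Y p - dir_deriv Y X p"

definition connection ::
    "(('a::real_normed_vector \<Rightarrow> 'a) \<Rightarrow> ('a \<Rightarrow> 'a) \<Rightarrow> ('a \<Rightarrow> 'a)) \<Rightarrow> bool" where
  "connection nabla \<longleftrightarrow>
     (\<forall>X Y. vector_field X \<longrightarrow> vector_field Y \<longrightarrow> vector_field (nabla X Y)) \<and>
     (\<forall>X X' Y p. vector_field X \<longrightarrow> vector_field X' \<longrightarrow> vector_field Y \<longrightarrow>
        nabla (\<lambda>q. X q + X' q) Y p = nabla X Y p + nabla X' Y p) \<and>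
     (\<forall>X Y Y' p. vector_field X \<longrightarrow> vector_field Y \<longrightarrow> vector_field Y' \<longrightarrow>
        nabla X (\<lambda>q. Y q + Y' q) p = nabla X Y p + nabla X Y' p) \<and>
     (\<forall>(f::'a \<Rightarrow> real) X Y p. smooth_on UNIV f \<longrightarrow> vector_field X \<longrightarrow> vector_field Y \<longrightarrow>
        nabla (\<lambda>q. f q *\<^sub>R X q) Y p = f p *\<^sub>R nabla X Y p) \<and>
     (\<forall>(f::'a \<Rightarrow> real) X Y p. smooth_on UNIV f \<longrightarrow> vector_field X \<longrightarrow> vector_field Y \<longrightarrow>
        nabla X (\<lambda>q. f q *\<^sub>R Y q) p = dir_deriv X f p *\<^sub>R Y p + f p *\<^sub>R nabla X Y p)"

definition torsion_free ::
    "(('a::real_normed_vector \<Rightarrow> 'a) \<Rightarrow> ('a \<Rightarrow> 'a) \<Rightarrow> ('a \<Rightarrow> 'a)) \<Rightarrow> bool" where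
  "torsion_free nabla \<longleftrightarrow>
     (\<forall>X Y p. vector_field X \<longrightarrow> vector_field Y \<longrightarrow>
        nabla X Y p - nabla Y X p = lie_bracket X Y p)"

definition curvature ::
    "(('a::real_normed_vector \<Rightarrow> 'a) \<Rightarrow> ('a \<Rightarrow> 'a) \<Rightarrow> ('a \<Rightarrow> 'a))
       \<Rightarrow> ('a \<Rightarrow> 'a) \<Rightarrow> ('a \<Rightarrow> 'a) \<Rightarrow> ('a \<Rightarrow> 'a) \<Rightarrow> 'a \<Rightarrow> 'a" where
  "curvature nabla X Y Z p =
     nabla X (nabla Y Z) p - nabla Y (nabla X Z) p - nabla (lie_bracket X Y) Z p"

text \<open>
  The value of the curvature at a point \<open>P\<close> is the operator \<open>R\<close> on the tangent space at \<open>P\<close>,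
  that is, on \<open>V\<close>, with \<open>R (X P) (Y P) (Z P) = (\<R>(X,Y)Z) P\<close> for all vector fields.
  It is unique, since every vector is the value at \<open>P\<close> of a vector field.
\<close>

definition has_curvature_at ::
    "(('a::real_normed_vector \<Rightarrow> 'a) \<Rightarrow> ('a \<Rightarrow> 'a) \<Rightarrow> ('a \<Rightarrow> 'a))
       \<Rightarrow> 'a \<Rightarrow> ('a \<Rightarrow> 'a \<Rightarrow> 'a \<Rightarrow> 'a) \<Rightarrow> bool" where
  "has_curvature_at nabla P R \<longleftrightarrow>
     (\<forall>X Y Z. vector_field X \<longrightarrow> vector_field Y \<longrightarrow> vector_field Z \<longrightarrow>
        curvature nabla X Y Z P = R (X P) (Y P) (Z P))"


section \<open>Parallel volume forms\<close>

text \<open>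
  Arguments of an exterior form of degree \<open>k\<close> are given as a list of length \<open>k\<close>; values at
  other lists are irrelevant.
\<close>

definition alternating_form :: "nat \<Rightarrow> ('a::real_vector list \<Rightarrow> real) \<Rightarrow> bool" where
  "alternating_form k w \<longleftrightarrow>
     (\<forall>vs i. length vs = k \<longrightarrow> i < k \<longrightarrow> linear (\<lambda>v. w (vs[i := v]))) \<and>
     (\<forall>vs i j. length vs = k \<longrightarrow> i < j \<longrightarrow> j < k \<longrightarrow> vs ! i = vs ! j \<longrightarrow> w vs = 0)"

definition differential_form_on ::
    "'a::real_normed_vector set \<Rightarrow> nat \<Rightarrow> ('a \<Rightarrow> 'a list \<Rightarrow> real) \<Rightarrow> bool" where
  "differential_form_on U k \<Omega> \<longleftrightarrow>
     (\<forall>p\<in>U. alternating_form k (\<Omega> p)) \<and>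
     (\<forall>vs. length vs = k \<longrightarrow> smooth_on U (\<lambda>p. \<Omega> p vs))"

definition volume_form_on ::
    "'a::real_normed_vector set \<Rightarrow> ('a \<Rightarrow> 'a list \<Rightarrow> real) \<Rightarrow> bool" where
  "volume_form_on U \<Omega> \<longleftrightarrow>
     differential_form_on U (dim (UNIV :: 'a set)) \<Omega> \<and>
     (\<forall>p\<in>U. \<exists>vs. length vs = dim (UNIV :: 'a set) \<and> \<Omega> p vs \<noteq> 0)"

text \<open>
  The covariant derivative of a form \<open>\<Omega>\<close> of degree \<open>k\<close> along \<open>X\<close>:
  \<open>(\<nabla>\<^sub>X \<Omega>)(Y\<^sub>1,\<dots>,Y\<^sub>k) = X (\<Omega>(Y\<^sub>1,\<dots>,Y\<^sub>k)) - (\<Sum>i. \<Omega>(Y\<^sub>1,\<dots>,\<nabla>\<^sub>X Y\<^sub>i,\<dots>,Y\<^sub>k))\<close>.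
\<close>

definition covariant_deriv_form ::
    "(('a::real_normed_vector \<Rightarrow> 'a) \<Rightarrow> ('a \<Rightarrow> 'a) \<Rightarrow> ('a \<Rightarrow> 'a))
       \<Rightarrow> ('a \<Rightarrow> 'a) \<Rightarrow> ('a \<Rightarrow> 'a list \<Rightarrow> real) \<Rightarrow> ('a \<Rightarrow> 'a) list \<Rightarrow> 'a \<Rightarrow> real" where
  "covariant_deriv_form nabla X \<Omega> Ys p =
     dir_deriv X (\<lambda>q. \<Omega> q (map (\<lambda>Y. Y q) Ys)) p
     - (\<Sum>i<length Ys. \<Omega> p ((map (\<lambda>Y. Y p) Ys)[i := nabla X (Ys ! i) p]))"

text \<open>
  Vector fields on all of \<open>V\<close> suffice to test \<open>\<nabla>\<Omega> = 0\<close> on an open set \<open>U\<close>: the covariant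
  derivative is tensorial in \<open>X\<close> and the \<open>Y\<^sub>i\<close>, so at each point only their values there count.
\<close>

definition parallel_form_on ::
    "(('a::real_normed_vector \<Rightarrow> 'a) \<Rightarrow> ('a \<Rightarrow> 'a) \<Rightarrow> ('a \<Rightarrow> 'a))
       \<Rightarrow> 'a set \<Rightarrow> nat \<Rightarrow> ('a \<Rightarrow> 'a list \<Rightarrow> real) \<Rightarrow> bool" where
  "parallel_form_on nabla U k \<Omega> \<longleftrightarrow>
     (\<forall>X Ys. vector_field X \<longrightarrow> length Ys = k \<longrightarrow> (\<forall>Y\<in>set Ys. vector_field Y) \<longrightarrow>
        (\<forall>p\<in>U. covariant_deriv_form nabla X \<Omega> Ys p = 0))"

definition equiaffine_connection ::
    "(('a::real_normed_vector \<Rightarrow> 'a) \<Rightarrow> ('a \<Rightarrow> 'a) \<Rightarrow> ('a \<Rightarrow> 'a)) \<Rightarrow> bool" where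
  "equiaffine_connection nabla \<longleftrightarrow>
     connection nabla \<and> torsion_free nabla \<and>
     (\<forall>P. \<exists>U \<Omega>. open U \<and> P \<in> U \<and> volume_form_on U \<Omega> \<and>
        parallel_form_on nabla U (dim (UNIV :: 'a set)) \<Omega>)"

end

theory Submission
  imports Defs "Jordan_Normal_Form.Determinant"
begin

text \<open>
  Take the connection with Christoffel symbol \<open>\<Gamma>\<^sub>p(u,v) = (A(p,u)v + A(p,v)u) / 3\<close>, which is linear in
  \<open>p\<close> and symmetric in \<open>u\<close>, \<open>v\<close>. As \<open>\<Gamma>\<^sub>0 = 0\<close>, its curvature at the origin is
  \<open>\<Gamma>\<^sub>x(y,z) - \<Gamma>\<^sub>y(x,z) = A(x,y)z\<close>, by the Bianchi identity. The trace of \<open>v \<mapsto> \<Gamma>\<^sub>p(u,v)\<close> is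
  \<open>-\<rho>(p,u) / 3\<close>, and since \<open>\<rho>\<close> is symmetric this is the derivative of \<open>p \<mapsto> -\<rho>(p,p) / 6\<close> along \<open>u\<close>.
  Hence \<open>exp(-\<rho>(p,p) / 6) det\<close> is a parallel volume form on the whole space.
\<close>

section \<open>Finite-dimensional normed spaces\<close>

text \<open>The space carries only a norm, with no inner product, so a fixed finite basis takes over
  the role of coordinates: boundedness, smoothness and traces are all reduced to it.\<close>

locale finite_basis =
  fixes B :: "'a::real_normed_vector set"
  assumes finite_B: "finite B"
    and independent_B: "independent B"
    and span_B: "span B = UNIV"
begin

lemma sum_coord: "(\<Sum>b\<in>B. representation B x b *\<^sub>R b) = x"
  by (rule real_vector.sum_representation_eq) (use independent_B span_B finite_B in auto)

lemma coord_eqI: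
  assumes "\<And>b. representation B x b = representation B y b"
  shows "x = y"
proof -
  have "x = (\<Sum>b\<in>B. representation B x b *\<^sub>R b)"
    by (simp only: sum_coord)
  also have "\<dots> = y"
    by (simp only: assms sum_coord)
  finally show ?thesis .
qed

lemma linear_coord: "linear (\<lambda>x. representation B x b)"
  by (rule linearI)
    (simp_all add: real_vector.representation_add real_vector.representation_scale independent_B span_B)

text \<open>Used in both directions: to replace a varying argument by fixed basis vectors with
  scalar coefficients, and, reversed, to collapse such a sum again.\<close>

lemma linear_expand:
  assumes "linear f"
  shows "f x = (\<Sum>b\<in>B. representation B x b *\<^sub>R f b)"
proof -
  have "f x = f (\<Sum>b\<in>B. representation B x b *\<^sub>R b)"
    by (simp add: sum_coord)
  also have "\<dots> = (\<Sum>b\<in>B. representation B x b *\<^sub>R f b)"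
    using assms by (simp add: linear_sum linear_scale)
  finally show ?thesis .
qed

text \<open>This is Tychonoff's theorem. Coefficient vectors are functions on the whole type with
  the product topology; a linear combination over \<open>B\<close> reads only their values on
  \<open>B\<close>.\<close>

lemma compact_Pi_Icc: "compact {c :: 'a \<Rightarrow> real. \<forall>b. c b \<in> {-1..1}}"
proof -
  have "compactin (product_topology (\<lambda>_. euclideanreal) (UNIV::'a set)) (PiE UNIV (\<lambda>_. {-1..1}))"
    by (simp add: compactin_PiE)
  then show ?thesis
    by (simp add: euclidean_product_topology PiE_UNIV_domain Pi_def)
qed

text \<open>The coefficient vectors of \<open>\<ell>\<^sup>1\<close>-norm 1 form a compact set, on which the norm of the
  linear combination attains a positive minimum.\<close>

lemma coord_bound: "\<exists>K. \<forall>x. (\<Sum>b\<in>B. \<bar>representation B x b\<bar>) \<le> norm x * K"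
proof (cases "B = {}")
  \<comment> \<open>For empty \<open>B\<close> no coefficient vector has absolute sum 1, so there
    would be nothing to minimise over.\<close>
  case True
  then show ?thesis by (auto intro: exI[of _ 0])
next
  case False
  define T where "T = {c :: 'a \<Rightarrow> real. \<forall>b. c b \<in> {-1..1}} \<inter> {c. (\<Sum>b\<in>B. \<bar>c b\<bar>) = 1}"
  define g where "g c = norm (\<Sum>b\<in>B. c b *\<^sub>R b)" for c :: "'a \<Rightarrow> real"
  have "closed {c :: 'a \<Rightarrow> real. (\<Sum>b\<in>B. \<bar>c b\<bar>) = 1}"
    by (intro closed_Collect_eq continuous_intros continuous_on_product_coordinates)
  then have compT: "compact T"
    unfolding T_def by (intro compact_Int_closed compact_Pi_Icc)
  have contg: "continuous_on T g"
    unfolding g_def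
    by (intro continuous_intros continuous_on_subset[OF continuous_on_product_coordinates]) auto
  obtain b0 where b0: "b0 \<in> B" using False by blast
  \<comment> \<open>The coefficient vector of \<open>b0\<close> itself shows that \<open>T\<close>
    is nonempty, as the extremum theorem requires.\<close>
  have "(\<lambda>b. if b = b0 then 1 else 0) \<in> T"
    using b0 finite_B by (auto simp: T_def if_distrib[of abs] sum.delta cong: if_cong)
  then obtain c0 where c0: "c0 \<in> T" and min: "\<And>c. c \<in> T \<Longrightarrow> g c0 \<le> g c"
    using continuous_attains_inf[OF compT _ contg] by blast
  have pos: "g c0 > 0"
  proof (rule ccontr)
    assume "\<not> ?thesis"
    then have "(\<Sum>b\<in>B. c0 b *\<^sub>R b) = 0" by (simp add: g_def)
    then have "\<forall>b\<in>B. c0 b = 0"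
      using independent_B finite_B real_vector.independentD by blast
    then show False using c0 by (simp add: T_def)
  qed
  have "(\<Sum>b\<in>B. \<bar>representation B x b\<bar>) \<le> norm x * (1 / g c0)" for x
  proof (cases "(\<Sum>b\<in>B. \<bar>representation B x b\<bar>) = 0")
    case True
    then show ?thesis using pos by simp
  next
    case nz: False
    define N where "N = (\<Sum>b\<in>B. \<bar>representation B x b\<bar>)"
    have N: "N > 0" using nz unfolding N_def by (simp add: order_less_le sum_nonneg)
    define c where "c b = representation B x b / N" for b
    \<comment> \<open>Membership in \<open>T\<close> constrains every coordinate, also those outside
      \<open>B\<close>, where the representation is 0.\<close>
    have "\<bar>representation B x b\<bar> \<le> N" for b
    proof (cases "b \<in> B")
      case True
      then show ?thesis unfolding N_def using finite_B by (intro member_le_sum) auto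
    next
      case False
      then have "representation B x b = 0"
        using real_vector.representation_ne_zero by blast
      then show ?thesis using N by simp
    qed
    then have "\<bar>c b\<bar> \<le> 1" for b using N by (simp add: c_def)
    then have "c b \<in> {-1..1}" for b by (simp add: abs_le_iff minus_le_iff)
    moreover have "(\<Sum>b\<in>B. \<bar>c b\<bar>) = 1"
      using N by (simp add: c_def abs_divide flip: sum_divide_distrib N_def)
    ultimately have "c \<in> T" by (simp add: T_def)
    then have "g c0 \<le> g c" by (rule min)
    also have "(\<Sum>b\<in>B. c b *\<^sub>R b) = (1 / N) *\<^sub>R x"
      by (subst (2) sum_coord[symmetric]) (simp add: c_def scaleR_sum_right)
    then have "g c = norm x / N" using N by (simp add: g_def)
    finally show ?thesis using N pos by (simp add: field_simps flip: N_def)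
  qed
  then show ?thesis by blast
qed

lemma bounded_linear_coord: "bounded_linear (\<lambda>x. representation B x b)"
proof -
  obtain K where K: "\<And>x. (\<Sum>b\<in>B. \<bar>representation B x b\<bar>) \<le> norm x * K"
    using coord_bound by blast
  have "norm (representation B x b) \<le> norm x * K" for x
  proof (cases "b \<in> B")
    case True
    then have "\<bar>representation B x b\<bar> \<le> (\<Sum>b\<in>B. \<bar>representation B x b\<bar>)"
      using finite_B by (intro member_le_sum) auto
    with K show ?thesis by (metis order_trans real_norm_def)
  next
    case False
    then have "representation B x b = 0"
      using real_vector.representation_ne_zero by blast
    moreover have "0 \<le> norm x * K"
      using K[of x] by (meson abs_ge_zero order_trans sum_nonneg)
    ultimately show ?thesis by simp
  qed
  with linear_coord show ?thesis
    by (metis bounded_linear.intro bounded_linear_axioms.intro)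
qed

lemma linear_imp_bounded_linear:
  fixes f :: "'a \<Rightarrow> 'c::real_normed_vector"
  assumes "linear f"
  shows "bounded_linear f"
proof -
  have "bounded_linear (\<lambda>x. \<Sum>b\<in>B. representation B x b *\<^sub>R f b)"
    by (intro bounded_linear_sum bounded_linear_scaleR_const bounded_linear_coord)
  then show ?thesis
    by (simp flip: linear_expand[OF assms])
qed

text \<open>Only the first argument is expanded in the basis. Each \<open>h b\<close> is then a
  bounded linear map of the second argument, and the finitely many bounds add up.\<close>

lemma bilinear_imp_bounded_bilinear:
  fixes h :: "'a \<Rightarrow> 'a \<Rightarrow> 'c::real_normed_vector"
  assumes "bilinear h"
  shows "bounded_bilinear h"
proof -
  have lin: "linear (h x)" "linear (\<lambda>x. h x y)" for x y
    using assms by (auto simp: bilinear_def)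
  have "\<exists>K. \<forall>x y. norm (h x y) \<le> norm x * norm y * K"
  proof -
    have "\<exists>K. \<forall>x. norm (representation B x b) \<le> norm x * K" for b
      using bounded_linear.bounded[OF bounded_linear_coord] .
    then obtain C where C: "\<And>b x. norm (representation B x b) \<le> norm x * C b" by metis
    have "\<exists>K. \<forall>x. norm (h b x) \<le> norm x * K" for b
      using bounded_linear.bounded[OF linear_imp_bounded_linear[OF lin(1)]] .
    then obtain K where K: "\<And>b x. norm (h b x) \<le> norm x * K b" by metis
    have "norm (h x y) \<le> norm x * norm y * (\<Sum>b\<in>B. C b * K b)" for x y
    proof -
      have "norm (h x y) = norm (\<Sum>b\<in>B. representation B x b *\<^sub>R h b y)"
        by (simp flip: linear_expand[OF lin(2)])
      also have "\<dots> \<le> (\<Sum>b\<in>B. norm (representation B x b) * norm (h b y))"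
        by (rule order_trans[OF norm_sum]) simp
      also have "\<dots> \<le> (\<Sum>b\<in>B. (norm x * C b) * (norm y * K b))"
        by (intro sum_mono mult_mono C K norm_ge_zero) (metis C norm_ge_zero order_trans)
      also have "\<dots> = norm x * norm y * (\<Sum>b\<in>B. C b * K b)"
        by (simp add: sum_distrib_left mult_ac)
      finally show ?thesis .
    qed
    then show ?thesis by blast
  qed
  then show ?thesis
    by unfold_locales (simp_all add: linear_add[OF lin(1)] linear_add[OF lin(2)]
        linear_scale[OF lin(1)] linear_scale[OF lin(2)])
qed

text \<open>Basis independence of the trace: the basis picked by \<open>SOME\<close> is compared
  with \<open>B\<close> by expanding its vectors in \<open>B\<close>, exchanging the sums, and
  collapsing the sum over the picked basis.\<close>

lemma endo_trace_eq:
  assumes "linear f"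
  shows "endo_trace f = (\<Sum>b\<in>B. representation B (f b) b)"
proof -
  define C :: "'a set" where "C = (SOME B. independent B \<and> span B = UNIV)"
  have C: "independent C" "span C = UNIV"
    using someI_ex[of "\<lambda>B. independent B \<and> span B = (UNIV :: 'a set)"] independent_B span_B
    unfolding C_def by blast+
  \<comment> \<open>An independent set in the span of a finite set is finite, so \<open>C\<close> is
    a second instance of the locale.\<close>
  have "finite C"
    using real_vector.independent_span_bound[OF finite_B C(1)] span_B by auto
  then interpret C: finite_basis C using C by unfold_locales
  have "(\<Sum>c\<in>C. representation C (f c) c)
      = (\<Sum>c\<in>C. \<Sum>b\<in>B. representation B c b * representation C (f b) c)"
    by (subst linear_expand[OF linear_compose[OF assms C.linear_coord, unfolded o_def]]) simp
  also have "\<dots> = (\<Sum>b\<in>B. \<Sum>c\<in>C. representation C (f b) c * representation B c b)"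
    by (subst sum.swap) (simp add: mult.commute)
  also have "\<dots> = (\<Sum>b\<in>B. representation B (f b) b)"
    by (subst (2) C.linear_expand[OF linear_coord]) simp
  finally show ?thesis by (simp add: endo_trace_def C_def)
qed

end

section \<open>Smooth maps on the whole space\<close>

lemma frechet_derivative_eq: "(f has_derivative f') (at x) \<Longrightarrow> frechet_derivative f (at x) = f'"
  by (metis frechet_derivative_at)

lemma has_derivative_frechet:
  "f differentiable (at x) \<Longrightarrow> (f has_derivative frechet_derivative f (at x)) (at x)"
  by (simp add: frechet_derivative_works)

text \<open>Serves the product rule, where each term keeps one factor undifferentiated and so must
  lower its order by one.\<close>

lemma higher_differentiable_on_mono_Suc:
  "higher_differentiable_on S f (Suc n) \<Longrightarrow> higher_differentiable_on S f n"
proof (induction n arbitrary: f)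
  case 0
  then show ?case
    by (auto intro!: continuous_at_imp_continuous_on differentiable_imp_continuous_within)
next
  case (Suc n)
  then show ?case by (metis higher_differentiable_on.simps(2))
qed

lemma smooth_on_differentiable: "smooth_on UNIV f \<Longrightarrow> f differentiable (at x)"
  unfolding smooth_on_def by (metis UNIV_I higher_differentiable_on.simps(2))

lemma smooth_on_has_derivative:
  "smooth_on UNIV f \<Longrightarrow> (f has_derivative frechet_derivative f (at x)) (at x)"
  by (intro has_derivative_frechet smooth_on_differentiable)

lemma smooth_on_frechet_derivative:
  "smooth_on UNIV f \<Longrightarrow> smooth_on UNIV (\<lambda>x. frechet_derivative f (at x) v)"
  unfolding smooth_on_def by (metis higher_differentiable_on.simps(2))

lemma smooth_on_continuous: "smooth_on UNIV f \<Longrightarrow> isCont f x"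
  by (intro differentiable_imp_continuous_within smooth_on_differentiable)

lemma higher_differentiable_on_const: "higher_differentiable_on UNIV (\<lambda>x. c) n"
  by (induction n arbitrary: c) auto

lemma smooth_on_const [simp]: "smooth_on UNIV (\<lambda>x. c)"
  by (simp add: smooth_on_def higher_differentiable_on_const)

text \<open>The derivative in a fixed direction is constant in the base point, so a case distinction
  on the order replaces induction.\<close>

lemma smooth_on_bounded_linear:
  assumes "bounded_linear h"
  shows "smooth_on UNIV h"
proof -
  have h: "(h has_derivative h) (at x)" for x
    using assms by (rule bounded_linear_imp_has_derivative)
  have "higher_differentiable_on UNIV h n" for n
    using h by (cases n)
      (auto simp: frechet_derivative_eq[OF h] higher_differentiable_on_const assms
        linear_continuous_on differentiable_def)
  then show ?thesis by (simp add: smooth_on_def)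
qed

lemma higher_differentiable_on_add:
  "higher_differentiable_on UNIV f n \<Longrightarrow> higher_differentiable_on UNIV g n \<Longrightarrow>
    higher_differentiable_on UNIV (\<lambda>x. f x + g x) n"
proof (induction n arbitrary: f g)
  case 0
  then show ?case by (auto intro: continuous_on_add)
next
  case (Suc n)
  have "frechet_derivative (\<lambda>x. f x + g x) (at x)
      = (\<lambda>v. frechet_derivative f (at x) v + frechet_derivative g (at x) v)" for x
    using Suc.prems by (intro frechet_derivative_eq has_derivative_add has_derivative_frechet) auto
  with Suc show ?case by simp
qed

lemma smooth_on_add:
  "smooth_on UNIV f \<Longrightarrow> smooth_on UNIV g \<Longrightarrow> smooth_on UNIV (\<lambda>x. f x + g x)"
  by (simp add: smooth_on_def higher_differentiable_on_add)

lemma smooth_on_sum: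
  "(\<And>i. i \<in> I \<Longrightarrow> smooth_on UNIV (f i)) \<Longrightarrow> smooth_on UNIV (\<lambda>x. \<Sum>i\<in>I. f i x)"
  by (induction I rule: infinite_finite_induct) (auto intro: smooth_on_add)

lemma (in bounded_linear) smooth_on_compose:
  assumes "smooth_on UNIV g"
  shows "smooth_on UNIV (\<lambda>x. f (g x))"
proof -
  have "higher_differentiable_on UNIV (\<lambda>x. f (g x)) n"
    if "higher_differentiable_on UNIV g n" for n and g :: "'c::real_normed_vector \<Rightarrow> 'a"
    using that
  proof (induction n arbitrary: g)
    case 0
    then show ?case by (auto intro: continuous_on)
  next
    case (Suc n)
    have D: "((\<lambda>x. f (g x)) has_derivative (\<lambda>v. f (frechet_derivative g (at x) v))) (at x)" for x
      using Suc.prems by (intro has_derivative has_derivative_frechet) auto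
    then have "(\<lambda>x. f (g x)) differentiable (at x)" for x
      by (auto simp: differentiable_def)
    with Suc show ?case by (simp add: frechet_derivative_eq[OF D])
  qed
  then show ?thesis using assms by (simp add: smooth_on_def)
qed

lemma (in bounded_bilinear) higher_differentiable_on_prod:
  "higher_differentiable_on UNIV f n \<Longrightarrow> higher_differentiable_on UNIV g n \<Longrightarrow>
    higher_differentiable_on UNIV (\<lambda>x. prod (f x) (g x)) n"
proof (induction n arbitrary: f g)
  case 0
  then show ?case by (auto intro: continuous_on)
next
  case (Suc n)
  have D: "((\<lambda>x. prod (f x) (g x)) has_derivative
      (\<lambda>v. prod (f x) (frechet_derivative g (at x) v) + prod (frechet_derivative f (at x) v) (g x))) (at x)"
    for x
    using Suc.prems by (intro FDERIV has_derivative_frechet) auto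
  then have "(\<lambda>x. prod (f x) (g x)) differentiable (at x)" for x
    by (auto simp: differentiable_def)
  moreover have "higher_differentiable_on UNIV
      (\<lambda>x. prod (f x) (frechet_derivative g (at x) v) + prod (frechet_derivative f (at x) v) (g x)) n" for v
  proof (intro higher_differentiable_on_add Suc.IH)
    show "higher_differentiable_on UNIV f n" "higher_differentiable_on UNIV g n"
      using Suc.prems by (blast intro: higher_differentiable_on_mono_Suc)+
  qed (use Suc.prems in auto)
  ultimately show ?case by (simp add: frechet_derivative_eq[OF D])
qed

lemma (in bounded_bilinear) smooth_on_prod:
  "smooth_on UNIV f \<Longrightarrow> smooth_on UNIV g \<Longrightarrow> smooth_on UNIV (\<lambda>x. prod (f x) (g x))"
  by (simp add: smooth_on_def higher_differentiable_on_prod)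

text \<open>The derivative is \<open>exp (f x)\<close> times a smooth function, so the induction
  hypothesis for the same \<open>f\<close> and the product rule suffice.\<close>

lemma smooth_on_exp:
  fixes f :: "'a::real_normed_vector \<Rightarrow> real"
  assumes "smooth_on UNIV f"
  shows "smooth_on UNIV (\<lambda>x. exp (f x))"
proof -
  have "higher_differentiable_on UNIV (\<lambda>x. exp (f x)) n" for n
  proof (induction n)
    case 0
    then show ?case
      using smooth_on_continuous[OF assms] by (auto intro!: continuous_on_exp continuous_at_imp_continuous_on)
  next
    case (Suc n)
    have D: "((\<lambda>x. exp (f x)) has_derivative (\<lambda>v. exp (f x) * frechet_derivative f (at x) v)) (at x)" for x
      using smooth_on_has_derivative[OF assms] by (auto intro!: derivative_eq_intros)
    then have "(\<lambda>x. exp (f x)) differentiable (at x)" for x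
      by (auto simp: differentiable_def)
    moreover have "higher_differentiable_on UNIV (\<lambda>x. frechet_derivative f (at x) v) n" for v
      using smooth_on_frechet_derivative[OF assms] by (simp add: smooth_on_def)
    ultimately show ?case
      using Suc by (simp add: frechet_derivative_eq[OF D]
          bounded_bilinear.higher_differentiable_on_prod[OF bounded_bilinear_mult])
  qed
  then show ?thesis by (simp add: smooth_on_def)
qed

text \<open>The definition of smoothness controls derivatives in fixed directions only, whereas the
  direction \<open>X p\<close> varies with the point. Expanding it in the basis separates the two
  dependences.\<close>

lemma (in finite_basis) smooth_on_dir_deriv:
  fixes f :: "'a \<Rightarrow> 'c::real_normed_vector"
  assumes "smooth_on UNIV X" "smooth_on UNIV f"
  shows "smooth_on UNIV (dir_deriv X f)"
proof -
  have "linear (frechet_derivative f (at p))" for p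
    using smooth_on_has_derivative[OF assms(2)] by (rule has_derivative_linear)
  then have "dir_deriv X f = (\<lambda>p. \<Sum>b\<in>B. representation B (X p) b *\<^sub>R frechet_derivative f (at p) b)"
    unfolding dir_deriv_def by (intro ext linear_expand)
  moreover have "smooth_on UNIV (\<lambda>p. \<Sum>b\<in>B. representation B (X p) b *\<^sub>R frechet_derivative f (at p) b)"
    by (intro smooth_on_sum bounded_bilinear.smooth_on_prod[OF bounded_bilinear_scaleR]
        bounded_linear.smooth_on_compose[OF bounded_linear_coord] smooth_on_frechet_derivative assms)
  ultimately show ?thesis by simp
qed

lemma dir_deriv_eq: "(f has_derivative f') (at p) \<Longrightarrow> dir_deriv X f p = f' (X p)"
  by (simp add: dir_deriv_def frechet_derivative_eq)

section \<open>Symmetry of the second derivative\<close>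

text \<open>The mean value theorem is applied twice: along \<open>u\<close> to the increment of
  \<open>f\<close> by \<open>h\<close> times \<open>v\<close>, then along \<open>v\<close> to the
  derivative of \<open>f\<close> in direction \<open>u\<close>.\<close>

lemma second_difference:
  fixes f :: "'a::real_normed_vector \<Rightarrow> real"
  assumes f: "\<And>x. f differentiable (at x)"
    and Du: "\<And>x. (\<lambda>x. frechet_derivative f (at x) u) differentiable (at x)"
    and "h > 0"
  shows "\<exists>s t. 0 < s \<and> s < h \<and> 0 < t \<and> t < h \<and>
    f (p + h *\<^sub>R u + h *\<^sub>R v) - f (p + h *\<^sub>R u) - f (p + h *\<^sub>R v) + f p
      = h * (h * frechet_derivative (\<lambda>x. frechet_derivative f (at x) u) (at (p + s *\<^sub>R u + t *\<^sub>R v)) v)"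
proof -
  have line: "((\<lambda>s. g (q + s *\<^sub>R w)) has_real_derivative frechet_derivative g (at (q + s *\<^sub>R w)) w) (at s)"
    if "\<And>x. g differentiable (at x)" for g :: "'a \<Rightarrow> real" and q w s
  proof -
    have "((\<lambda>s. g (q + s *\<^sub>R w)) has_derivative
        (\<lambda>t. frechet_derivative g (at (q + s *\<^sub>R w)) (t *\<^sub>R w))) (at s)"
      by (rule has_derivative_compose[where f = "\<lambda>s. q + s *\<^sub>R w", OF _ has_derivative_frechet[OF that]])
        (auto intro!: derivative_eq_intros)
    moreover have "linear (frechet_derivative g (at (q + s *\<^sub>R w)))"
      using has_derivative_frechet[OF that] by (rule has_derivative_linear)
    ultimately show ?thesis
      by (simp add: has_field_derivative_def linear_scale mult.commute[of _ "frechet_derivative _ _ _"])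
  qed
  let ?Du = "\<lambda>x. frechet_derivative f (at x) u"
  \<comment> \<open>The terms \<open>0 *\<^sub>R u\<close> and \<open>h - 0\<close> keep the shape
    in which \<open>MVT2\<close> delivers its conclusion.\<close>
  have "\<exists>s>0. s < h \<and> (f ((p + h *\<^sub>R v) + h *\<^sub>R u) - f (p + h *\<^sub>R u))
      - (f ((p + h *\<^sub>R v) + 0 *\<^sub>R u) - f (p + 0 *\<^sub>R u))
      = (h - 0) * (?Du ((p + h *\<^sub>R v) + s *\<^sub>R u) - ?Du (p + s *\<^sub>R u))"
    by (rule MVT2[OF \<open>h > 0\<close>, where f = "\<lambda>s. f ((p + h *\<^sub>R v) + s *\<^sub>R u) - f (p + s *\<^sub>R u)"])
      (intro DERIV_diff line f)
  then obtain s where s: "0 < s" "s < h" and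
    1: "(f ((p + h *\<^sub>R v) + h *\<^sub>R u) - f (p + h *\<^sub>R u))
      - (f ((p + h *\<^sub>R v) + 0 *\<^sub>R u) - f (p + 0 *\<^sub>R u))
      = (h - 0) * (?Du ((p + h *\<^sub>R v) + s *\<^sub>R u) - ?Du (p + s *\<^sub>R u))"
    by blast
  have "\<exists>t>0. t < h \<and> ?Du ((p + s *\<^sub>R u) + h *\<^sub>R v) - ?Du ((p + s *\<^sub>R u) + 0 *\<^sub>R v)
      = (h - 0) * frechet_derivative ?Du (at ((p + s *\<^sub>R u) + t *\<^sub>R v)) v"
    by (rule MVT2[OF \<open>h > 0\<close>, where f = "\<lambda>t. ?Du ((p + s *\<^sub>R u) + t *\<^sub>R v)"]) (intro line Du)
  then obtain t where t: "0 < t" "t < h" and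
    2: "?Du ((p + s *\<^sub>R u) + h *\<^sub>R v) - ?Du ((p + s *\<^sub>R u) + 0 *\<^sub>R v)
      = (h - 0) * frechet_derivative ?Du (at ((p + s *\<^sub>R u) + t *\<^sub>R v)) v"
    by blast
  from 1 2 have "f (p + h *\<^sub>R u + h *\<^sub>R v) - f (p + h *\<^sub>R u) - f (p + h *\<^sub>R v) + f p
      = h * (h * frechet_derivative ?Du (at (p + s *\<^sub>R u + t *\<^sub>R v)) v)"
    by (simp add: add_ac)
  with s t show ?thesis by blast
qed

text \<open>The second difference is symmetric in the two directions. Divided by the squared step it
  equals the mixed derivative at points tending to \<open>p\<close>, and that derivative is
  continuous, so both mixed derivatives are limits of one sequence.\<close>

lemma symmetric_second_derivative_real:
  fixes f :: "'a::real_normed_vector \<Rightarrow> real"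
  assumes f: "smooth_on UNIV f"
  shows "frechet_derivative (\<lambda>x. frechet_derivative f (at x) u) (at p) v
    = frechet_derivative (\<lambda>x. frechet_derivative f (at x) v) (at p) u"
proof -
  define D where "D u v x = frechet_derivative (\<lambda>x. frechet_derivative f (at x) u) (at x) v" for u v x
  define d where "d u v h =
    f (p + h *\<^sub>R u + h *\<^sub>R v) - f (p + h *\<^sub>R u) - f (p + h *\<^sub>R v) + f p" for u v h
  have lim: "(\<lambda>n. d u v (1 / real (Suc n)) / (1 / real (Suc n))\<^sup>2) \<longlonglongrightarrow> D u v p" for u v
  proof -
    have "\<exists>s t. 0 < s \<and> s < 1 / real (Suc n) \<and> 0 < t \<and> t < 1 / real (Suc n) \<and>
      d u v (1 / real (Suc n))
        = 1 / real (Suc n) * (1 / real (Suc n) * D u v (p + s *\<^sub>R u + t *\<^sub>R v))" for n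
      unfolding d_def D_def
      by (rule second_difference)
        (auto intro: smooth_on_differentiable smooth_on_frechet_derivative f)
    then obtain s t where st: "\<And>n. 0 < s n" "\<And>n. s n < 1 / real (Suc n)" "\<And>n. 0 < t n"
        "\<And>n. t n < 1 / real (Suc n)" and
      d: "\<And>n. d u v (1 / real (Suc n))
        = 1 / real (Suc n) * (1 / real (Suc n) * D u v (p + s n *\<^sub>R u + t n *\<^sub>R v))"
      by metis
    have z: "(\<lambda>n. 1 / real (Suc n)) \<longlonglongrightarrow> 0"
      using LIMSEQ_inverse_real_of_nat by (simp add: inverse_eq_divide)
    have "s \<longlonglongrightarrow> 0"
      by (rule tendsto_sandwich[OF _ _ tendsto_const z]) (intro eventuallyI less_imp_le st)+
    moreover have "t \<longlonglongrightarrow> 0"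
      by (rule tendsto_sandwich[OF _ _ tendsto_const z]) (intro eventuallyI less_imp_le st)+
    ultimately have "(\<lambda>n. p + s n *\<^sub>R u + t n *\<^sub>R v) \<longlonglongrightarrow> p + 0 *\<^sub>R u + 0 *\<^sub>R v"
      by (intro tendsto_intros)
    moreover have "isCont (D u v) (p + 0 *\<^sub>R u + 0 *\<^sub>R v)"
      unfolding D_def by (intro smooth_on_continuous smooth_on_frechet_derivative f)
    ultimately have "(\<lambda>n. D u v (p + s n *\<^sub>R u + t n *\<^sub>R v)) \<longlonglongrightarrow> D u v (p + 0 *\<^sub>R u + 0 *\<^sub>R v)"
      by (rule isCont_tendsto_compose[rotated])
    then have "(\<lambda>n. D u v (p + s n *\<^sub>R u + t n *\<^sub>R v)) \<longlonglongrightarrow> D u v p"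
      by (simp only: scaleR_zero_left add_0_right)
    moreover have "D u v (p + s n *\<^sub>R u + t n *\<^sub>R v) = d u v (1 / real (Suc n)) / (1 / real (Suc n))\<^sup>2" for n
    proof -
      have "x = y / h\<^sup>2" if "y = h * (h * x)" "h \<noteq> 0" for h x y :: real
        using that by (simp add: power2_eq_square)
      from this[OF d] show ?thesis by simp
    qed
    ultimately show ?thesis by (simp only:)
  qed
  have "d v u = d u v" by (auto simp: d_def algebra_simps)
  then have "D u v p = D v u p"
    using LIMSEQ_unique[OF lim[of u v]] lim[of v u] by metis
  then show ?thesis by (simp add: D_def)
qed

text \<open>Taking coordinates commutes with differentiation, which reduces the claim to real-valued
  maps, where the mean value theorem is available.\<close>

lemma (in finite_basis) symmetric_second_derivative:
  fixes f :: "'c::real_normed_vector \<Rightarrow> 'a"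
  assumes f: "smooth_on UNIV f"
  shows "frechet_derivative (\<lambda>x. frechet_derivative f (at x) u) (at p) v
    = frechet_derivative (\<lambda>x. frechet_derivative f (at x) v) (at p) u"
proof -
  have D: "frechet_derivative (\<lambda>x. representation B (g x) b) (at x) v
      = representation B (frechet_derivative g (at x) v) b"
    if "smooth_on UNIV g" for g :: "'c \<Rightarrow> 'a" and x v b
    by (simp add: frechet_derivative_eq[OF bounded_linear.has_derivative[OF bounded_linear_coord
            smooth_on_has_derivative[OF that]]])
  have "representation B (frechet_derivative (\<lambda>x. frechet_derivative f (at x) u) (at p) v) b
    = representation B (frechet_derivative (\<lambda>x. frechet_derivative f (at x) v) (at p) u) b" for b
    using symmetric_second_derivative_real[OF bounded_linear.smooth_on_compose[OF bounded_linear_coord f],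
        where u = u and v = v and p = p]
    by (simp add: D f smooth_on_frechet_derivative)
  then show ?thesis by (rule coord_eqI)
qed

section \<open>Determinant forms\<close>

context finite_basis
begin

text \<open>Matrices are indexed by numbers, so the basis has to be enumerated. Another order would
  change \<open>vol\<close> at most by a sign.\<close>

definition basis_list :: "'a list" where
  "basis_list = (SOME bs. set bs = B \<and> distinct bs)"

definition coord_mat :: "'a list \<Rightarrow> real mat" where
  "coord_mat vs =
    mat (card B) (card B) (\<lambda>(i, j). representation B (vs ! i) (basis_list ! j))"

definition vol :: "'a list \<Rightarrow> real" where
  "vol vs = Determinant.det (coord_mat vs)"

lemma basis_list: "set basis_list = B" "distinct basis_list"
  using someI_ex[OF finite_distinct_list[OF finite_B]] unfolding basis_list_def by auto

lemma length_basis_list: "length basis_list = card B"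
  using basis_list distinct_card by metis

lemma sum_basis_list: "(\<Sum>b\<in>B. f b) = (\<Sum>j<card B. f (basis_list ! j))"
  by (rule sum.reindex_bij_betw[symmetric], rule bij_betw_nth)
    (simp_all add: basis_list length_basis_list)

lemma coord_mat_carrier: "coord_mat vs \<in> carrier_mat (card B) (card B)"
  by (simp add: coord_mat_def)

text \<open>Laplace expansion along row \<open>i\<close>, whose cofactors do not see that row. This
  exhibits the dependence on the replaced vector as linear.\<close>

lemma vol_update:
  assumes "length vs = card B" "i < card B"
  shows "vol (vs[i := v])
    = (\<Sum>j<card B. representation B v (basis_list ! j) * cofactor (coord_mat vs) i j)"
proof -
  let ?N = "coord_mat (vs[i := v])"
  have "mat_delete ?N i j = mat_delete (coord_mat vs) i j" for j
    unfolding mat_delete_def coord_mat_def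
    by (rule cong_mat) (auto simp: assms)
  then have "cofactor ?N i j = cofactor (coord_mat vs) i j" for j
    by (simp add: cofactor_def)
  moreover have "?N $$ (i, j) = representation B v (basis_list ! j)" if "j < card B" for j
    using that assms by (simp add: coord_mat_def)
  ultimately show ?thesis
    unfolding vol_def laplace_expansion_row[OF coord_mat_carrier assms(2)] by simp
qed

lemma alternating_form_vol: "alternating_form (card B) vol"
proof -
  have "linear (\<lambda>v. vol (vs[i := v]))" if "length vs = card B" "i < card B" for vs i
    by (rule linearI) (simp_all add: vol_update that linear_add[OF linear_coord]
        linear_scale[OF linear_coord] distrib_right sum.distrib sum_distrib_left mult.assoc)
  moreover have "vol vs = 0" if "i < j" "j < card B" "vs ! i = vs ! j" for vs i j
    unfolding vol_def
  proof (rule det_identical_rows[OF coord_mat_carrier, of i j])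
    show "Matrix.row (coord_mat vs) i = Matrix.row (coord_mat vs) j"
      using that by (intro eq_vecI) (simp_all add: coord_mat_def)
  qed (use that in auto)
  ultimately show ?thesis by (auto simp: alternating_form_def)
qed

text \<open>Provides the arguments at which the volume form is nonzero.\<close>

lemma vol_basis_list: "vol basis_list = 1"
proof -
  have "coord_mat basis_list = 1\<^sub>m (card B)"
  proof (rule eq_matI)
    fix i j assume "i < dim_row (1\<^sub>m (card B) :: real mat)" "j < dim_col (1\<^sub>m (card B) :: real mat)"
    then have ij: "i < card B" "j < card B" by auto
    then have "basis_list ! i \<in> B"
      using basis_list length_basis_list nth_mem by metis
    then show "coord_mat basis_list $$ (i, j) = 1\<^sub>m (card B) $$ (i, j)"
      using ij by (auto simp: coord_mat_def real_vector.representation_basis[OF independent_B]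
          nth_eq_iff_index_eq[OF basis_list(2)] length_basis_list)
  qed (auto simp: coord_mat_def)
  then show ?thesis by (simp add: vol_def)
qed

text \<open>Expanding each determinant along its new row, the cofactors recombine to
  \<open>adj M * M = det M * 1\<close>.\<close>

lemma sum_vol_update_linear:
  assumes "linear L" and len: "length vs = card B"
  shows "(\<Sum>i<card B. vol (vs[i := L (vs ! i)])) = endo_trace L * vol vs"
proof -
  let ?k = "card B" and ?M = "coord_mat vs"
  \<comment> \<open>The matrix of \<open>L\<close>, with the image of the \<open>l\<close>-th basis
    vector in row \<open>l\<close>, matching the row convention of \<open>coord_mat\<close>.\<close>
  define t where "t l j = representation B (L (basis_list ! l)) (basis_list ! j)" for l j
  have adj: "(\<Sum>i<?k. cofactor ?M i j * ?M $$ (i, l)) = (if j = l then vol vs else 0)"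
    if "j < ?k" "l < ?k" for j l
  proof -
    have "(adj_mat ?M * ?M) $$ (j, l) = (\<Sum>i<?k. cofactor ?M i j * ?M $$ (i, l))"
      using that
      by (auto simp: times_mat_def scalar_prod_def adj_mat_def coord_mat_def
          lessThan_atLeast0 intro!: sum.cong)
    then show ?thesis
      using that by (cases "j = l") (simp_all add: adj_mat(3)[OF coord_mat_carrier] vol_def)
  qed
  have L: "representation B (L (vs ! i)) (basis_list ! j) = (\<Sum>l<?k. ?M $$ (i, l) * t l j)"
    if "i < ?k" for i j
    using that
    by (subst linear_expand[OF linear_compose[OF assms(1) linear_coord, unfolded o_def]])
      (simp add: sum_basis_list t_def coord_mat_def)
  have "(\<Sum>i<?k. vol (vs[i := L (vs ! i)]))
      = (\<Sum>i<?k. \<Sum>j<?k. \<Sum>l<?k. t l j * (cofactor ?M i j * ?M $$ (i, l)))"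
    by (simp add: vol_update len L sum_distrib_left sum_distrib_right mult_ac)
  also have "\<dots> = (\<Sum>j<?k. \<Sum>i<?k. \<Sum>l<?k. t l j * (cofactor ?M i j * ?M $$ (i, l)))"
    by (rule sum.swap)
  also have "\<dots> = (\<Sum>j<?k. \<Sum>l<?k. t l j * (\<Sum>i<?k. cofactor ?M i j * ?M $$ (i, l)))"
    by (rule sum.cong[OF refl], subst sum.swap) (simp add: sum_distrib_left)
  also have "\<dots> = (\<Sum>j<?k. t j j * vol vs)"
    by (simp add: adj if_distrib[of "(*) _"] cong: if_cong)
  also have "\<dots> = endo_trace L * vol vs"
    by (simp add: endo_trace_eq[OF assms(1)] sum_basis_list t_def sum_distrib_right)
  finally show ?thesis .
qed

text \<open>The Leibniz formula is a finite sum of products of coordinates, so the product rule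
  applies. The terms in which row \<open>i\<close> is differentiated recombine to the determinant
  with that row replaced.\<close>

lemma has_derivative_vol:
  assumes Y: "\<And>i. i < card B \<Longrightarrow> ((Ys ! i) has_derivative Y' i) (at p)"
    and len: "length Ys = card B"
  shows "((\<lambda>q. vol (map (\<lambda>Y. Y q) Ys)) has_derivative
    (\<lambda>h. \<Sum>i<card B. vol ((map (\<lambda>Y. Y p) Ys)[i := Y' i h]))) (at p)"
proof -
  let ?k = "card B"
  define c where "c i j v = representation B v (basis_list ! j)" for i j :: nat and v
  have vol: "vol vs = (\<Sum>\<pi> | \<pi> permutes {0..<?k}. signof \<pi> * (\<Prod>i=0..<?k. c i (\<pi> i) (vs ! i)))"
    for vs
    unfolding vol_def det_def'[OF coord_mat_carrier]
    by (intro sum.cong refl arg_cong2[of _ _ _ _ "(*)"] prod.cong)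
      (auto simp: coord_mat_def c_def permutes_in_image)
  have *: "((\<lambda>q. vol (map (\<lambda>Y. Y q) Ys)) has_derivative
    (\<lambda>h. \<Sum>\<pi> | \<pi> permutes {0..<?k}. signof \<pi> *
      (\<Sum>i=0..<?k. c i (\<pi> i) (Y' i h) * (\<Prod>j\<in>{0..<?k} - {i}. c j (\<pi> j) ((Ys ! j) p))))) (at p)"
  proof -
    have "((\<lambda>q. c i j ((Ys ! i) q)) has_derivative (\<lambda>h. c i j (Y' i h))) (at p)" if "i < ?k" for i j
      unfolding c_def by (intro bounded_linear.has_derivative[OF bounded_linear_coord] Y that)
    then have "((\<lambda>q. \<Sum>\<pi> | \<pi> permutes {0..<?k}. signof \<pi> * (\<Prod>i=0..<?k. c i (\<pi> i) ((Ys ! i) q)))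
      has_derivative (\<lambda>h. \<Sum>\<pi> | \<pi> permutes {0..<?k}. signof \<pi> *
      (\<Sum>i=0..<?k. c i (\<pi> i) (Y' i h) * (\<Prod>j\<in>{0..<?k} - {i}. c j (\<pi> j) ((Ys ! j) p))))) (at p)"
      by (intro has_derivative_sum has_derivative_mult_right has_derivative_prod) auto
    then show ?thesis
      by (simp add: vol len)
  qed
  \<comment> \<open>Replacing row \<open>i\<close> affects only the \<open>i\<close>-th factor of
    each Leibniz product.\<close>
  have upd: "(\<Prod>j=0..<?k. c j (\<pi> j) ((map (\<lambda>Y. Y p) Ys)[i := w] ! j))
      = c i (\<pi> i) w * (\<Prod>j\<in>{0..<?k} - {i}. c j (\<pi> j) ((Ys ! j) p))" if "i < ?k" for i \<pi> w
    using that by (subst prod.remove[of _ i]) (auto simp: len intro!: prod.cong)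
  have "(\<Sum>\<pi> | \<pi> permutes {0..<?k}. signof \<pi> *
      (\<Sum>i=0..<?k. c i (\<pi> i) (Y' i h) * (\<Prod>j\<in>{0..<?k} - {i}. c j (\<pi> j) ((Ys ! j) p))))
    = (\<Sum>i<?k. vol ((map (\<lambda>Y. Y p) Ys)[i := Y' i h]))" for h
    unfolding vol sum_distrib_left
    by (subst sum.swap) (auto simp: upd lessThan_atLeast0 intro!: sum.cong)
  with * show ?thesis by simp
qed

end

section \<open>The connection\<close>

lemma alternating_form_scale:
  "alternating_form k w \<Longrightarrow> alternating_form k (\<lambda>vs. c * w vs)"
  unfolding alternating_form_def
  using linear_compose_scale_right[of _ c, where ?'b = real] by auto

context finite_basis
begin

lemma dim_UNIV_eq: "dim (UNIV :: 'a set) = card B"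
  using real_vector.dim_eq_card[of B UNIV] independent_B span_B by simp

text \<open>Product rule for the derivative of \<open>Z\<close> applied to the varying vector
  \<open>Y q\<close>, obtained through the basis expansion of that vector.\<close>

lemma has_derivative_dir_deriv:
  fixes Z :: "'a \<Rightarrow> 'a"
  assumes Y: "smooth_on UNIV Y" and Z: "smooth_on UNIV Z"
  shows "(dir_deriv Y Z has_derivative
    (\<lambda>h. frechet_derivative (\<lambda>x. frechet_derivative Z (at x) h) (at p) (Y p)
      + frechet_derivative Z (at p) (frechet_derivative Y (at p) h))) (at p)"
proof -
  have lin: "linear (frechet_derivative f (at q))" if "smooth_on UNIV f" for f :: "'a \<Rightarrow> 'a" and q
    using smooth_on_has_derivative[OF that] by (rule has_derivative_linear)
  have "dir_deriv Y Z = (\<lambda>q. \<Sum>b\<in>B. representation B (Y q) b *\<^sub>R frechet_derivative Z (at q) b)"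
    unfolding dir_deriv_def by (rule ext, rule linear_expand[OF lin[OF Z]])
  moreover have "((\<lambda>q. \<Sum>b\<in>B. representation B (Y q) b *\<^sub>R frechet_derivative Z (at q) b) has_derivative
    (\<lambda>h. \<Sum>b\<in>B. representation B (Y p) b *\<^sub>R frechet_derivative (\<lambda>x. frechet_derivative Z (at x) b) (at p) h
      + representation B (frechet_derivative Y (at p) h) b *\<^sub>R frechet_derivative Z (at p) b)) (at p)"
    by (intro has_derivative_sum has_derivative_scaleR
        bounded_linear.has_derivative[OF bounded_linear_coord]
        smooth_on_has_derivative smooth_on_frechet_derivative Y Z)
  moreover have "(\<Sum>b\<in>B. representation B (Y p) b *\<^sub>R frechet_derivative (\<lambda>x. frechet_derivative Z (at x) b) (at p) h
      + representation B (frechet_derivative Y (at p) h) b *\<^sub>R frechet_derivative Z (at p) b)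
    = frechet_derivative (\<lambda>x. frechet_derivative Z (at x) h) (at p) (Y p)
      + frechet_derivative Z (at p) (frechet_derivative Y (at p) h)" for h
    \<comment> \<open>Symmetry moves the basis vector to the outer derivative, which is linear in
      its direction, so the sum collapses to direction \<open>Y p\<close>.\<close>
    unfolding sum.distrib symmetric_second_derivative[OF Z, of _ p h]
    by (simp only: linear_expand[OF lin[OF Z], symmetric]
        linear_expand[OF lin[OF smooth_on_frechet_derivative[OF Z]], symmetric])
  ultimately show ?thesis by simp
qed

end

locale equiaffine_operator = finite_basis B for B :: "'a::real_normed_vector set" +
  fixes A :: "'a \<Rightarrow> 'a \<Rightarrow> 'a \<Rightarrow> 'a"
  assumes equiaffine_A: "equiaffine_curvature_operator A"
begin

lemma linear_A:
  "linear (\<lambda>x. A x y z)" "linear (\<lambda>y. A x y z)" "linear (\<lambda>z. A x y z)"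
  using equiaffine_A
  unfolding equiaffine_curvature_operator_def algebraic_curvature_operator_def by blast+

lemma A_antisym: "A x y z = - A y x z"
  using equiaffine_A
  unfolding equiaffine_curvature_operator_def algebraic_curvature_operator_def by blast

lemma A_bianchi: "A x y z + A y z x + A z x y = 0"
  using equiaffine_A
  unfolding equiaffine_curvature_operator_def algebraic_curvature_operator_def by blast

lemma ricci_sym: "ricci A x y = ricci A y x"
  using equiaffine_A unfolding equiaffine_curvature_operator_def by blast

lemmas A_simps =
  linear_add[OF linear_A(1)] linear_add[OF linear_A(2)] linear_add[OF linear_A(3)]
  linear_scale[OF linear_A(1)] linear_scale[OF linear_A(2)] linear_scale[OF linear_A(3)]

lemma bounded_bilinear_A: "bounded_bilinear (A x)"
  by (rule bilinear_imp_bounded_bilinear) (simp add: bilinear_def linear_A)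

text \<open>Trilinearity is handled by expanding the first argument; for each basis vector there
  remains a bounded bilinear map of the other two.\<close>

lemma smooth_on_A:
  assumes "smooth_on UNIV f" "smooth_on UNIV g" "smooth_on UNIV h"
  shows "smooth_on UNIV (\<lambda>p. A (f p) (g p) (h p))"
proof -
  have "smooth_on UNIV (\<lambda>p. \<Sum>b\<in>B. representation B (f p) b *\<^sub>R A b (g p) (h p))"
    by (intro smooth_on_sum bounded_bilinear.smooth_on_prod[OF bounded_bilinear_scaleR]
        bounded_bilinear.smooth_on_prod[OF bounded_bilinear_A]
        bounded_linear.smooth_on_compose[OF bounded_linear_coord] assms)
  then show ?thesis by (simp only: linear_expand[OF linear_A(1), symmetric])
qed

text \<open>At the origin every product rule term that keeps the coordinates of \<open>q\<close>
  vanishes, so the derivatives of \<open>g\<close> and \<open>h\<close> drop out.\<close>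

lemma has_derivative_A_at_0:
  assumes "smooth_on UNIV g" "smooth_on UNIV h"
  shows "((\<lambda>q. A q (g q) (h q)) has_derivative (\<lambda>v. A v (g 0) (h 0))) (at 0)"
proof -
  have gh: "smooth_on UNIV (\<lambda>q. A b (g q) (h q))" for b
    by (intro smooth_on_A assms) simp
  have "((\<lambda>q. \<Sum>b\<in>B. representation B q b *\<^sub>R A b (g q) (h q)) has_derivative
    (\<lambda>v. \<Sum>b\<in>B. representation B 0 b *\<^sub>R frechet_derivative (\<lambda>q. A b (g q) (h q)) (at 0) v
      + representation B v b *\<^sub>R A b (g 0) (h 0))) (at 0)"
    by (intro has_derivative_sum has_derivative_scaleR smooth_on_has_derivative gh
        bounded_linear_imp_has_derivative bounded_linear_coord)
  then show ?thesis
    by (simp only: linear_expand[OF linear_A(1), symmetric] linear_0[OF linear_coord]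
        scaleR_zero_left add_0_left)
qed

section \<open>The Christoffel symbol, its connection, and the curvature at the origin\<close>

definition christoffel :: "'a \<Rightarrow> 'a \<Rightarrow> 'a \<Rightarrow> 'a" where
  "christoffel p u v = (1/3) *\<^sub>R (A p u v + A p v u)"

definition nabla :: "('a \<Rightarrow> 'a) \<Rightarrow> ('a \<Rightarrow> 'a) \<Rightarrow> 'a \<Rightarrow> 'a" where
  "nabla X Y p = dir_deriv X Y p + christoffel p (X p) (Y p)"

lemma christoffel_commute: "christoffel p u v = christoffel p v u"
  by (simp add: christoffel_def add.commute)

lemma linear_christoffel: "linear (christoffel p u)"
  by (rule linearI) (simp_all add: christoffel_def A_simps algebra_simps)

lemma smooth_on_christoffel:
  "smooth_on UNIV X \<Longrightarrow> smooth_on UNIV Y \<Longrightarrow> smooth_on UNIV (\<lambda>p. christoffel p (X p) (Y p))"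
  unfolding christoffel_def
  by (intro bounded_linear.smooth_on_compose[OF bounded_linear_scaleR_right] smooth_on_add
      smooth_on_A smooth_on_bounded_linear[OF bounded_linear_ident])

lemma connection_nabla: "connection nabla"
  unfolding connection_def
proof (intro conjI allI impI)
  fix X X' Y Y' :: "'a \<Rightarrow> 'a" and f :: "'a \<Rightarrow> real" and p
  assume X: "vector_field X" and Y: "vector_field Y"
  have linD: "linear (frechet_derivative Y (at p))"
    using smooth_on_has_derivative[OF Y] by (rule has_derivative_linear)
  note simps = nabla_def linear_add[OF linD] linear_scale[OF linD]
    linear_add[OF linear_christoffel] linear_scale[OF linear_christoffel]
  show "vector_field (nabla X Y)"
    unfolding nabla_def by (intro smooth_on_add smooth_on_dir_deriv smooth_on_christoffel X Y)
  \<comment> \<open>Symmetry of \<open>christoffel\<close> carries the direction into the slot for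
    which linearity is established.\<close>
  show "nabla (\<lambda>q. X q + X' q) Y p = nabla X Y p + nabla X' Y p"
    by (simp add: simps dir_deriv_def christoffel_commute[of p _ "Y p"])
  show "nabla (\<lambda>q. f q *\<^sub>R X q) Y p = f p *\<^sub>R nabla X Y p"
    by (simp add: simps dir_deriv_def christoffel_commute[of p _ "Y p"] scaleR_add_right)
  show "nabla X (\<lambda>q. Y q + Y' q) p = nabla X Y p + nabla X Y' p" if Y': "vector_field Y'"
    by (simp add: simps dir_deriv_eq[OF has_derivative_add[OF smooth_on_has_derivative[OF Y]
            smooth_on_has_derivative[OF Y']]])
      (simp add: dir_deriv_def)
  show "nabla X (\<lambda>q. f q *\<^sub>R Y q) p = dir_deriv X f p *\<^sub>R Y p + f p *\<^sub>R nabla X Y p"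
    if f: "smooth_on UNIV f"
    by (simp add: simps scaleR_add_right dir_deriv_eq[OF has_derivative_scaleR[OF
            smooth_on_has_derivative[OF f] smooth_on_has_derivative[OF Y]]])
      (simp add: dir_deriv_def)
qed

lemma torsion_free_nabla: "torsion_free nabla"
  by (simp add: torsion_free_def nabla_def lie_bracket_def christoffel_commute)

lemma has_curvature_at_nabla: "has_curvature_at nabla 0 A"
  unfolding has_curvature_at_def
proof (intro allI impI)
  fix X Y Z :: "'a \<Rightarrow> 'a"
  assume X: "vector_field X" and Y: "vector_field Y" and Z: "vector_field Z"
  define D where "D f = frechet_derivative f (at (0::'a))" for f :: "'a \<Rightarrow> 'a"
  have "christoffel 0 u v = 0" for u v
    by (simp add: christoffel_def linear_0[OF linear_A(1)])
  then have nabla_0: "nabla U V 0 = D V (U 0)" for U V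
    by (simp add: nabla_def dir_deriv_def D_def)
  \<comment> \<open>The outer derivative at the origin is the plain one. Its first two terms
    differentiate \<open>dir_deriv V Z\<close>; the third comes from the linear dependence of
    \<open>christoffel\<close> on the base point.\<close>
  have second: "nabla U (nabla V Z) 0
      = D (\<lambda>x. frechet_derivative Z (at x) (U 0)) (V 0) + D Z (D V (U 0)) + christoffel (U 0) (V 0) (Z 0)"
    if "vector_field V" for U V
  proof -
    have "((\<lambda>q. christoffel q (V q) (Z q)) has_derivative (\<lambda>h. christoffel h (V 0) (Z 0))) (at 0)"
      unfolding christoffel_def
      by (intro has_derivative_scaleR_right has_derivative_add has_derivative_A_at_0 that Z)
    from has_derivative_add[OF has_derivative_dir_deriv[OF that Z] this]
    show ?thesis
      unfolding nabla_0 D_def nabla_def[of V Z, abs_def] by (simp add: frechet_derivative_eq)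
  qed
  have "linear (D Z)"
    unfolding D_def using smooth_on_has_derivative[OF Z] by (rule has_derivative_linear)
  then have bracket: "nabla (lie_bracket X Y) Z 0 = D Z (D Y (X 0)) - D Z (D X (Y 0))"
    by (simp add: nabla_0 lie_bracket_def dir_deriv_def linear_diff flip: D_def)
  \<comment> \<open>The second-order terms cancel by this symmetry and the first-order terms against
    the bracket; only Christoffel terms survive.\<close>
  have "D (\<lambda>x. frechet_derivative Z (at x) (X 0)) (Y 0) = D (\<lambda>x. frechet_derivative Z (at x) (Y 0)) (X 0)"
    unfolding D_def by (rule symmetric_second_derivative[OF Z])
  then have "curvature nabla X Y Z 0 = christoffel (X 0) (Y 0) (Z 0) - christoffel (Y 0) (X 0) (Z 0)"
    by (simp add: curvature_def second X Y bracket)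
  also have "\<dots> = A (X 0) (Y 0) (Z 0)"
  proof -
    let ?x = "X 0" and ?y = "Y 0" and ?z = "Z 0"
    \<comment> \<open>With this form of the Bianchi identity the four remaining terms add up to
      three copies of \<open>A ?x ?y ?z\<close>, which the factor 1/3 normalises.\<close>
    have "A ?x ?z ?y = A ?x ?y ?z + A ?y ?z ?x"
      using A_bianchi[of ?x ?y ?z] A_antisym[of ?z ?x ?y] by (simp add: eq_neg_iff_add_eq_0)
    then have "A ?x ?y ?z + A ?x ?z ?y - (A ?y ?x ?z + A ?y ?z ?x) = 3 *\<^sub>R A ?x ?y ?z"
      using A_antisym[of ?y ?x ?z] scaleR_left_distrib[of 2 1 "A ?x ?y ?z"] by (simp add: scaleR_2)
    then show ?thesis by (simp add: christoffel_def flip: scaleR_diff_right)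
  qed
  finally show "curvature nabla X Y Z 0 = A (X 0) (Y 0) (Z 0)" .
qed

section \<open>The Ricci tensor and the parallel volume form\<close>

lemma ricci_eq: "ricci A x y = (\<Sum>b\<in>B. representation B (A b x y) b)"
  unfolding ricci_def by (rule endo_trace_eq[OF linear_A(1)])

lemma bounded_bilinear_ricci: "bounded_bilinear (ricci A)"
  by (rule bilinear_imp_bounded_bilinear)
    (auto simp: bilinear_def ricci_eq[abs_def] A_simps linear_add[OF linear_coord]
      linear_scale[OF linear_coord] sum.distrib sum_distrib_left intro!: linearI)

lemma trace_christoffel: "endo_trace (christoffel p u) = - (1/3) * ricci A p u"
proof -
  \<comment> \<open>Antisymmetry and Bianchi bring the traced vector \<open>b\<close> into the first
    slot, where the Ricci tensor takes its trace.\<close>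
  have "A p u b + A p b u = A b u p - 2 *\<^sub>R A b p u" for b
    using A_bianchi[of p u b] A_antisym[of p b u] A_antisym[of u b p]
    by (simp add: algebra_simps eq_neg_iff_add_eq_0 scaleR_2)
  then have "endo_trace (christoffel p u)
      = (\<Sum>b\<in>B. (1/3) * (representation B (A b u p) b - 2 * representation B (A b p u) b))"
    by (simp add: endo_trace_eq[OF linear_christoffel] christoffel_def linear_scale[OF linear_coord]
        linear_diff[OF linear_coord])
  also have "\<dots> = (1/3) * (ricci A u p - 2 * ricci A p u)"
    by (simp add: ricci_eq sum_subtractf flip: sum_distrib_left sum_divide_distrib)
  finally show ?thesis by (simp add: ricci_sym[of u p])
qed

definition log_density :: "'a \<Rightarrow> real" where
  "log_density p = - (1/6) * ricci A p p"

definition vol_form :: "'a \<Rightarrow> 'a list \<Rightarrow> real" where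
  "vol_form p vs = exp (log_density p) * vol vs"

text \<open>Differentiating the quadratic form yields both orders of the Ricci arguments. Their
  equality doubles the factor 1/6 to the 1/3 of \<open>trace_christoffel\<close>; here the Ricci
  symmetry makes the trace form exact.\<close>

lemma has_derivative_log_density:
  "(log_density has_derivative (\<lambda>h. endo_trace (christoffel p h))) (at p)"
proof -
  have "(log_density has_derivative (\<lambda>h. - (1/6) * (ricci A p h + ricci A h p))) (at p)"
    unfolding log_density_def[abs_def]
    by (intro has_derivative_mult_right bounded_bilinear.FDERIV[OF bounded_bilinear_ricci]
        has_derivative_ident)
  then show ?thesis by (simp add: trace_christoffel ricci_sym[of _ p])
qed

lemma smooth_on_log_density: "smooth_on UNIV log_density"
  unfolding log_density_def[abs_def]
  by (intro bounded_linear.smooth_on_compose[OF bounded_linear_mult_right]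
      bounded_bilinear.smooth_on_prod[OF bounded_bilinear_ricci]
      smooth_on_bounded_linear[OF bounded_linear_ident])

lemma volume_form_on_vol_form: "volume_form_on UNIV vol_form"
proof -
  have "smooth_on UNIV (\<lambda>p. vol_form p vs)" for vs
    unfolding vol_form_def
    by (intro bounded_linear.smooth_on_compose[OF bounded_linear_mult_left] smooth_on_exp
        smooth_on_log_density)
  moreover have "alternating_form (card B) (vol_form p)" for p
    unfolding vol_form_def[abs_def] by (intro alternating_form_scale alternating_form_vol)
  moreover have "vol_form p basis_list \<noteq> 0" for p
    by (simp add: vol_form_def vol_basis_list)
  ultimately show ?thesis
    unfolding volume_form_on_def differential_form_on_def dim_UNIV_eq
    using length_basis_list by blast
qed

text \<open>Differentiating the density produces the trace of the Christoffel map times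
  \<open>vol\<close>; by \<open>sum_vol_update_linear\<close> this is what the Christoffel parts of
  the covariant derivatives of the arguments contribute. The plain derivatives of the arguments
  match term by term.\<close>

lemma parallel_form_on_vol_form: "parallel_form_on nabla UNIV (card B) vol_form"
  unfolding parallel_form_on_def
proof (intro allI impI ballI)
  fix X :: "'a \<Rightarrow> 'a" and Ys :: "('a \<Rightarrow> 'a) list" and p :: 'a
  assume X: "vector_field X" and len: "length Ys = card B" and Ys: "\<forall>Y\<in>set Ys. vector_field Y"
  let ?vs = "map (\<lambda>Y. Y p) Ys"
  let ?S = "\<Sum>i<card B. vol (?vs[i := frechet_derivative (Ys ! i) (at p) (X p)])"
  let ?L = "christoffel p (X p)"
  have D: "((\<lambda>q. vol (map (\<lambda>Y. Y q) Ys)) has_derivative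
      (\<lambda>h. \<Sum>i<card B. vol (?vs[i := frechet_derivative (Ys ! i) (at p) h]))) (at p)"
    by (rule has_derivative_vol) (use Ys len in \<open>auto intro: smooth_on_has_derivative\<close>)
  have "dir_deriv X (\<lambda>q. vol_form q (map (\<lambda>Y. Y q) Ys)) p
      = exp (log_density p) * (?S + endo_trace ?L * vol ?vs)"
    unfolding vol_form_def
    by (subst dir_deriv_eq[OF has_derivative_mult[OF has_derivative_exp[OF has_derivative_log_density] D]])
      (simp add: algebra_simps)
  \<comment> \<open>Linearity in slot \<open>i\<close> splits the covariant derivative into its
    directional and Christoffel parts.\<close>
  moreover have "vol (?vs[i := nabla X (Ys ! i) p])
      = vol (?vs[i := frechet_derivative (Ys ! i) (at p) (X p)]) + vol (?vs[i := ?L (?vs ! i)])"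
    if "i < card B" for i
  proof -
    have "linear (\<lambda>v. vol (?vs[i := v]))"
      using alternating_form_vol that len unfolding alternating_form_def by simp
    then show ?thesis
      using that by (simp add: nabla_def dir_deriv_def len linear_add[of "\<lambda>v. vol (?vs[i := v])"])
  qed
  then have "(\<Sum>i<card B. vol (?vs[i := nabla X (Ys ! i) p]))
      = ?S + (\<Sum>i<card B. vol (?vs[i := ?L (?vs ! i)]))"
    by (simp add: sum.distrib)
  then have "(\<Sum>i<length Ys. vol_form p (?vs[i := nabla X (Ys ! i) p]))
      = exp (log_density p) * (?S + endo_trace ?L * vol ?vs)"
    using sum_vol_update_linear[OF linear_christoffel, of ?vs p "X p"] len
    by (simp add: vol_form_def flip: sum_distrib_left)
  ultimately show "covariant_deriv_form nabla X vol_form Ys p = 0"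
    by (simp add: covariant_deriv_form_def)
qed

lemma equiaffine_connection_nabla: "equiaffine_connection nabla"
  unfolding equiaffine_connection_def dim_UNIV_eq
  using connection_nabla torsion_free_nabla volume_form_on_vol_form parallel_form_on_vol_form
  by blast

end

theorem theorem3:
  fixes A :: "'a::real_normed_vector \<Rightarrow> 'a \<Rightarrow> 'a \<Rightarrow> 'a"
  assumes finite_dim: "\<exists>B :: 'a set. finite B \<and> span B = UNIV"
    and A: "equiaffine_curvature_operator A"
  shows "\<exists>nabla. equiaffine_connection nabla \<and> has_curvature_at nabla 0 A"
proof -
  obtain S :: "'a set" where S: "finite S" "span S = UNIV"
    using finite_dim by blast
  \<comment> \<open>A basis chosen inside the finite spanning set is itself finite.\<close>
  obtain B where B: "B \<subseteq> S" "independent B" "S \<subseteq> span B"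
    using real_vector.maximal_independent_subset by blast
  then have "span B = UNIV"
    using S real_vector.span_minimal[OF B(3)] by auto
  then interpret equiaffine_operator B A
    by unfold_locales (use B S A finite_subset in auto)
  show ?thesis
    using equiaffine_connection_nabla has_curvature_at_nabla by blast
qed

end
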